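(* If $\mathbf{F}(s)$ is a T-admissible Dirichlet series, then $\mathbf{F}(s)$ is admissible.
   Context: Write $s=\sigma+it$. Suppose $\mathbf{F}(s)$ satisfies: (A1) $\mathbf{F}(s)=\sum_{n\ge1}f(n)n^{-s}$ is a Dirichlet series with nonnegative real coefficients and $f(1)>0$; (A2) its abscissa of (absolute) convergence is $\alpha\in[0,\infty)$; (A3) $\mathbf{F}(s)$ has no zeros in the half-plane $\sigma>\alpha$. Then $\mathbf{F}(s)=e^{\mathbf{H}(s)}$ for $\sigma>\alpha$, where $\mathbf{H}$ is the holomorphic logarithm of $\mathbf{F}$ that is real on $(\alpha,\infty)$. Put $\mathbf{a}=\mathbf{H}'$, $\mathbf{b}=\mathbf{H}''$, $\mathbf{c}=\mathbf{H}'''$ (complex derivatives), and define the remainder $\mathsf{R}$ by $\mathbf{H}(\sigma+it)=\mathbf{H}(\sigma)+i\mathbf{a}(\sigma)t-\tfrac{\mathbf{b}(\sigma)}{2}t^2+\mathsf{R}(\sigma+it)$ for $\sigma>\alpha$, $t\in\mathbb{R}$. Admissible: $\mathbf{F}$ satisfies (A1)-(A3) and there are $\beta>\alpha$ and a function $\delta:(\alpha,\beta)\to(0,1)$ such that, as $\sigma\to\alpha^+$: (A4) $\delta(\sigma)\to0$; (A5) $\sigma^2\mathbf{b}(\sigma)\to\infty$; (A6) $\mathbf{b}(\sigma)\exp\big(-\mathbf{b}(\sigma)\delta(\sigma)^2\big)\to0$; (A7) $\mathsf{R}(\sigma+it)\to0$ uniformly for $|t|\le\delta(\sigma)$; (A8)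 $\displaystyle\frac{\sigma\sqrt{\mathbf{b}(\sigma)}}{\mathbf{F}(\sigma)}\int_{|t|\ge\delta(\sigma)}|\mathbf{F}(\sigma+it)|\,\frac{dt}{\sigma^2+t^2}\to0$. T-admissible: $\mathbf{F}$ satisfies (A1)-(A3) and there are $\beta>\alpha$, with $\mathbf{b}(\sigma)\mathbf{c}(\sigma)\ne0$ on $(\alpha,\beta)$, and a function $T:(\alpha,\beta)\to(0,\infty)$ such that, with limits taken as $\sigma\to\alpha^+$: (T1) $\sigma^2\mathbf{b}(\sigma)\to\infty$; (T2) $\mathbf{b}(\sigma)^3/\mathbf{c}(\sigma)^2\to\infty$; (T3) $T(\sigma)\,|\mathbf{F}(\sigma+it)|/\mathbf{F}(\sigma)\le1$ for all $\sigma\in(\alpha,\beta)$ and all $t$ with $\delta(\sigma)\le|t|\le T(\sigma)$, where $\delta(\sigma)=|\mathbf{b}(\sigma)\mathbf{c}(\sigma)|^{-1/5}$; (T4) $\sqrt{\mathbf{b}(\sigma)}/T(\sigma)\to0$; (T5) $|\mathbf{c}(\sigma+it)|\le|\mathbf{c}(\sigma)|$ for all $\sigma\in(\alpha,\beta)$ and $t\in\mathbb{R}$; (T6) $\liminf_{\sigma\to\alpha^+}|\mathbf{c}(\sigma)|>0$. *)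

theory Defs
  imports "HOL-Complex_Analysis.Complex_Analysis"
begin

text \<open>
  A Dirichlet series is given by its coefficients \<open>f :: nat \<Rightarrow> real\<close>; the value \<open>f 0\<close> is
  irrelevant, since the sum over \<open>n \<ge> 1\<close> is written as a sum over \<open>Suc n\<close>.
\<close>

definition dir_term :: "(nat \<Rightarrow> real) \<Rightarrow> complex \<Rightarrow> nat \<Rightarrow> complex" where
  "dir_term f s n = of_real (f (Suc n)) * of_nat (Suc n) powr (- s)"

definition dir_series :: "(nat \<Rightarrow> real) \<Rightarrow> complex \<Rightarrow> complex" where
  "dir_series f s = (\<Sum>n. dir_term f s n)"

definition dir_abscissa :: "(nat \<Rightarrow> real) \<Rightarrow> ereal" where
  "dir_abscissa f =
     Inf {ereal \<sigma> | \<sigma>. summable (\<lambda>n. norm (dir_term f (of_real \<sigma>) n))}"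

text \<open>Only meaningful when \<^term>\<open>dir_abscissa f\<close> is finite.\<close>

definition dir_alpha :: "(nat \<Rightarrow> real) \<Rightarrow> real" where
  "dir_alpha f = real_of_ereal (dir_abscissa f)"

definition zero_free_dirichlet :: "(nat \<Rightarrow> real) \<Rightarrow> bool" where
  "zero_free_dirichlet f \<longleftrightarrow>
     (\<forall>n\<ge>1. f n \<ge> 0) \<and> f 1 > 0 \<and>
     0 \<le> dir_abscissa f \<and> dir_abscissa f < \<infinity> \<and>
     (\<forall>s. Re s > dir_alpha f \<longrightarrow> dir_series f s \<noteq> 0)"

text \<open>
  If \<^term>\<open>zero_free_dirichlet f\<close> holds, a function with the following three properties exists
  and its values on the half-plane are unique: two such functions differ there by a constant in
  \<open>2\<pi>i\<int>\<close>, which is real and hence \<open>0\<close>. All uses below are at points of the (open) half-plane.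
\<close>

definition dir_log :: "(nat \<Rightarrow> real) \<Rightarrow> complex \<Rightarrow> complex" where
  "dir_log f = (SOME H.
     H holomorphic_on {s. Re s > dir_alpha f} \<and>
     (\<forall>s. Re s > dir_alpha f \<longrightarrow> dir_series f s = exp (H s)) \<and>
     (\<forall>\<sigma>::real. \<sigma> > dir_alpha f \<longrightarrow> H (of_real \<sigma>) \<in> \<real>))"

definition dir_a :: "(nat \<Rightarrow> real) \<Rightarrow> complex \<Rightarrow> complex" where
  "dir_a f = deriv (dir_log f)"

definition dir_b :: "(nat \<Rightarrow> real) \<Rightarrow> complex \<Rightarrow> complex" where
  "dir_b f = (deriv ^^ 2) (dir_log f)"

definition dir_c :: "(nat \<Rightarrow> real) \<Rightarrow> complex \<Rightarrow> complex" where
  "dir_c f = (deriv ^^ 3) (dir_log f)"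

text \<open>
  The series and the derivatives of its logarithm take real values on the real half-line to the
  right of the abscissa; the following are these values as real numbers.
\<close>

definition F_real :: "(nat \<Rightarrow> real) \<Rightarrow> real \<Rightarrow> real" where
  "F_real f \<sigma> = Re (dir_series f (of_real \<sigma>))"

definition b_real :: "(nat \<Rightarrow> real) \<Rightarrow> real \<Rightarrow> real" where
  "b_real f \<sigma> = Re (dir_b f (of_real \<sigma>))"

definition c_real :: "(nat \<Rightarrow> real) \<Rightarrow> real \<Rightarrow> real" where
  "c_real f \<sigma> = Re (dir_c f (of_real \<sigma>))"

definition dir_remainder :: "(nat \<Rightarrow> real) \<Rightarrow> complex \<Rightarrow> complex" where
  "dir_remainder f s =
     dir_log f s -
       (dir_log f (of_real (Re s)) + \<i> * dir_a f (of_real (Re s)) * of_real (Im s)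
        - dir_b f (of_real (Re s)) / 2 * of_real (Im s) ^ 2)"

text \<open>
  The integrand in the last condition is bounded by \<open>F(\<sigma>) / (\<sigma>\<^sup>2 + t\<^sup>2)\<close> with \<open>\<sigma> > \<alpha> \<ge> 0\<close>, so
  the Lebesgue integral always exists as a finite number. The limit conditions only involve the
  values of \<open>\<delta>\<close> (and \<open>T\<close> below) on \<open>(\<alpha>, \<beta>)\<close>.
\<close>

definition admissible :: "(nat \<Rightarrow> real) \<Rightarrow> bool" where
  "admissible f \<longleftrightarrow> zero_free_dirichlet f \<and>
     (let \<alpha> = dir_alpha f; F = F_real f; b = b_real f in
      \<exists>\<beta>>\<alpha>. \<exists>\<delta>::real \<Rightarrow> real.
        (\<forall>\<sigma>\<in>{\<alpha><..<\<beta>}. 0 < \<delta> \<sigma> \<and> \<delta> \<sigma> < 1) \<and>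
        (\<delta> \<longlongrightarrow> 0) (at_right \<alpha>) \<and>
        filterlim (\<lambda>\<sigma>. \<sigma>\<^sup>2 * b \<sigma>) at_top (at_right \<alpha>) \<and>
        ((\<lambda>\<sigma>. b \<sigma> * exp (- b \<sigma> * (\<delta> \<sigma>)\<^sup>2)) \<longlongrightarrow> 0) (at_right \<alpha>) \<and>
        (\<forall>\<epsilon>>0. \<forall>\<^sub>F \<sigma> in at_right \<alpha>. \<forall>t. \<bar>t\<bar> \<le> \<delta> \<sigma> \<longrightarrow> norm (dir_remainder f (Complex \<sigma> t)) < \<epsilon>) \<and>
        ((\<lambda>\<sigma>. \<sigma> * sqrt (b \<sigma>) / F \<sigma> *
            (LINT t:{t. \<bar>t\<bar> \<ge> \<delta> \<sigma>}|lborel. norm (dir_series f (Complex \<sigma> t)) / (\<sigma>\<^sup>2 + t\<^sup>2)))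
          \<longlongrightarrow> 0) (at_right \<alpha>))"

definition T_admissible :: "(nat \<Rightarrow> real) \<Rightarrow> bool" where
  "T_admissible f \<longleftrightarrow> zero_free_dirichlet f \<and>
     (let \<alpha> = dir_alpha f; F = F_real f; b = b_real f; c = c_real f;
          \<delta> = (\<lambda>\<sigma>. \<bar>b \<sigma> * c \<sigma>\<bar> powr (- 1 / 5)) in
      \<exists>\<beta>>\<alpha>. \<exists>T::real \<Rightarrow> real.
        (\<forall>\<sigma>\<in>{\<alpha><..<\<beta>}. b \<sigma> * c \<sigma> \<noteq> 0) \<and>
        (\<forall>\<sigma>\<in>{\<alpha><..<\<beta>}. T \<sigma> > 0) \<and>
        filterlim (\<lambda>\<sigma>. \<sigma>\<^sup>2 * b \<sigma>) at_top (at_right \<alpha>) \<and>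
        filterlim (\<lambda>\<sigma>. b \<sigma> ^ 3 / (c \<sigma>)\<^sup>2) at_top (at_right \<alpha>) \<and>
        (\<forall>\<sigma>\<in>{\<alpha><..<\<beta>}. \<forall>t. \<delta> \<sigma> \<le> \<bar>t\<bar> \<and> \<bar>t\<bar> \<le> T \<sigma> \<longrightarrow>
            T \<sigma> * norm (dir_series f (Complex \<sigma> t)) / F \<sigma> \<le> 1) \<and>
        ((\<lambda>\<sigma>. sqrt (b \<sigma>) / T \<sigma>) \<longlongrightarrow> 0) (at_right \<alpha>) \<and>
        (\<forall>\<sigma>\<in>{\<alpha><..<\<beta>}. \<forall>t. norm (dir_c f (Complex \<sigma> t)) \<le> \<bar>c \<sigma>\<bar>) \<and>
        Liminf (at_right \<alpha>) (\<lambda>\<sigma>. ereal \<bar>c \<sigma>\<bar>) > 0)"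

end

theory Submission
  imports Defs "HOL-Probability.Sinc_Integral"
begin

text \<open>
  The same \<open>\<delta> = \<bar>b c\<bar>\<^sup>-\<^sup>1\<^sup>/\<^sup>5\<close> works. By (T2) and (T6), \<open>b \<rightarrow> \<infinity>\<close> and \<open>\<delta> \<rightarrow> 0\<close>. Taylor's formula on the vertical
  line through \<open>\<sigma>\<close> and (T5) bound the remainder on \<open>\<bar>t\<bar> \<le> \<delta>\<close> by \<open>\<bar>c\<bar> \<delta>\<^sup>3 = (b\<^sup>3 / c\<^sup>2)\<^sup>-\<^sup>1\<^sup>/\<^sup>5\<close>, which tends to \<open>0\<close> by (T2).
  Evaluating (T3) at \<open>t = \<delta>\<close> gives \<open>T exp (- b \<delta>\<^sup>2 / 2) = O(1)\<close>, so \<open>b exp (- b \<delta>\<^sup>2) = O(b / T\<^sup>2)\<close> and (T4) yields (A6).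
  The tail integral is at most \<open>F(\<sigma>) O(1 / (\<sigma> T) + 1 / T)\<close>, using (T3) up to \<open>T\<close> and \<open>\<bar>F(\<sigma> + it)\<bar> \<le> F(\<sigma>)\<close> beyond it.
\<close>

section \<open>Absolute convergence, holomorphy and positivity of the series\<close>

lemma norm_dir_term:
  "norm (dir_term f s n) = \<bar>f (Suc n)\<bar> * real (Suc n) powr (- Re s)"
  unfolding dir_term_def norm_mult
  by (subst norm_powr_real_powr) (auto simp: of_nat_Suc simp flip: of_nat_Suc)

lemma dir_abscissa_eq:
  assumes "zero_free_dirichlet f"
  shows "dir_abscissa f = ereal (dir_alpha f)"
  using assms unfolding zero_free_dirichlet_def dir_alpha_def
  by (cases "dir_abscissa f") auto

lemma dir_alpha_nonneg:
  assumes "zero_free_dirichlet f"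
  shows "0 \<le> dir_alpha f"
  using dir_abscissa_eq[OF assms] assms by (auto simp: zero_free_dirichlet_def)

text \<open>The infimum defining the abscissa yields a point \<open>\<tau>\<close> of absolute
  convergence to the left of \<open>Re s\<close>. Since \<open>Suc n \<ge> 1\<close>, the norms of
  the terms do not increase with the real part, so the terms at \<open>\<tau>\<close>
  dominate.\<close>

lemma summable_norm_dir_term:
  assumes "zero_free_dirichlet f" and "dir_alpha f < Re s"
  shows "summable (\<lambda>n. norm (dir_term f s n))"
proof -
  have "dir_abscissa f < ereal (Re s)"
    using dir_abscissa_eq[OF assms(1)] assms(2) by simp
  then obtain \<tau> where \<tau>: "\<tau> < Re s" "summable (\<lambda>n. norm (dir_term f (of_real \<tau>) n))"
    unfolding dir_abscissa_def Inf_less_iff by auto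
  show ?thesis
  proof (rule summable_comparison_test'[OF \<tau>(2), of 0])
    fix n :: nat
    show "norm (norm (dir_term f s n)) \<le> norm (dir_term f (of_real \<tau>) n)"
      using \<tau>(1) by (auto simp: norm_dir_term intro!: mult_left_mono powr_mono)
  qed
qed

lemma holomorphic_on_dir_series:
  assumes "zero_free_dirichlet f"
  shows "dir_series f holomorphic_on {s. dir_alpha f < Re s}"
proof (rule holomorphic_uniform_sequence)
  show "open {s. dir_alpha f < Re s}"
    by (rule open_halfspace_Re_gt)
  show "(\<lambda>s. \<Sum>i<n. dir_term f s i) holomorphic_on {s. dir_alpha f < Re s}" for n
    unfolding dir_term_def by (intro holomorphic_intros)
  fix s assume "s \<in> {s. dir_alpha f < Re s}"
  then have s: "dir_alpha f < Re s" by simp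
  \<comment> \<open>Half the distance to the boundary line keeps the closed disc inside the
    half-plane. \<open>\<tau>\<close> is the least real part in the disc, so the terms there serve
    as majorants in the M-test.\<close>
  define d where "d = (Re s - dir_alpha f) / 2"
  define \<tau> where "\<tau> = Re s - d"
  have d: "0 < d" "dir_alpha f < \<tau>"
    using s by (auto simp: d_def \<tau>_def field_simps)
  have Re_ge: "\<tau> \<le> Re z" if "z \<in> cball s d" for z
    using abs_Re_le_cmod[of "s - z"] that by (auto simp: \<tau>_def dist_norm)
  have "uniform_limit (cball s d) (\<lambda>n z. \<Sum>i<n. dir_term f z i) (dir_series f) sequentially"
    unfolding dir_series_def
  proof (rule Weierstrass_m_test)
    show "summable (\<lambda>n. norm (dir_term f (of_real \<tau>) n))"
      using d(2) by (intro summable_norm_dir_term assms) simp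
    show "norm (dir_term f z n) \<le> norm (dir_term f (of_real \<tau>) n)" if "z \<in> cball s d" for n z
      using Re_ge[OF that] by (auto simp: norm_dir_term intro!: mult_left_mono powr_mono)
  qed
  moreover have "cball s d \<subseteq> {s. dir_alpha f < Re s}"
    using Re_ge d(2) by force
  ultimately show "\<exists>d>0. cball s d \<subseteq> {s. dir_alpha f < Re s} \<and>
      uniform_limit (cball s d) (\<lambda>n z. \<Sum>i<n. dir_term f z i) (dir_series f) sequentially"
    using d(1) by blast
qed

lemma dir_term_of_real:
  "dir_term f (of_real \<sigma>) n = of_real (f (Suc n) * real (Suc n) powr (- \<sigma>))"
proof -
  have "complex_of_real (real (Suc n) powr (- \<sigma>)) = of_nat (Suc n) powr (- of_real \<sigma>)"
    by (subst powr_of_real[symmetric]) auto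
  then show ?thesis
    unfolding dir_term_def by (simp only: of_real_mult)
qed

text \<open>Nonnegative coefficients make every term on the real axis equal to its norm. Strict
  positivity then follows from the absence of zeros.\<close>

lemma dir_series_of_real:
  assumes "zero_free_dirichlet f" and "dir_alpha f < \<sigma>"
  shows "dir_series f (of_real \<sigma>) = of_real (F_real f \<sigma>)"
    and "F_real f \<sigma> = (\<Sum>n. norm (dir_term f (of_real \<sigma>) n))"
    and "0 < F_real f \<sigma>"
proof -
  have sm: "summable (\<lambda>n. norm (dir_term f (of_real \<sigma>) n))"
    using assms by (intro summable_norm_dir_term) auto
  have nonneg: "0 \<le> f (Suc n)" for n
    using assms by (auto simp: zero_free_dirichlet_def)
  have eq: "dir_term f (of_real \<sigma>) n = of_real (norm (dir_term f (of_real \<sigma>) n))" for n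
    unfolding dir_term_of_real using nonneg[of n] by (simp only: norm_of_real) simp
  have *: "dir_series f (of_real \<sigma>) = of_real (\<Sum>n. norm (dir_term f (of_real \<sigma>) n))"
    unfolding dir_series_def using suminf_of_real[OF sm, where ?'a = complex] by (simp only: eq[symmetric])
  then show F: "F_real f \<sigma> = (\<Sum>n. norm (dir_term f (of_real \<sigma>) n))"
    unfolding F_real_def by simp
  with * show "dir_series f (of_real \<sigma>) = of_real (F_real f \<sigma>)"
    by simp
  moreover have "dir_series f (of_real \<sigma>) \<noteq> 0"
    using assms by (auto simp: zero_free_dirichlet_def)
  ultimately have "F_real f \<sigma> \<noteq> 0" by auto
  moreover have "0 \<le> F_real f \<sigma>"
    unfolding F using sm by (intro suminf_nonneg) auto
  ultimately show "0 < F_real f \<sigma>" by simp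
qed

lemma norm_dir_series_le:
  assumes "zero_free_dirichlet f" and "dir_alpha f < \<sigma>"
  shows "norm (dir_series f (Complex \<sigma> t)) \<le> F_real f \<sigma>"
proof -
  have "norm (dir_series f (Complex \<sigma> t)) \<le> (\<Sum>n. norm (dir_term f (Complex \<sigma> t) n))"
    unfolding dir_series_def using assms by (intro summable_norm summable_norm_dir_term) auto
  also have "\<dots> = F_real f \<sigma>"
    unfolding dir_series_of_real(2)[OF assms] by (simp add: norm_dir_term)
  finally show ?thesis .
qed

section \<open>The logarithm that is real on the real axis\<close>

text \<open>Convexity of the half-plane gives some holomorphic logarithm \<open>g\<close>. The
  series is positive on the real half-line, so \<open>Im g\<close> is there an integer multiple of
  \<open>2 * pi\<close>; by continuity the integer is constant, and subtracting this multiple makes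
  the logarithm real.\<close>

lemma dir_log_exists:
  assumes "zero_free_dirichlet f"
  shows "\<exists>H. H holomorphic_on {s. Re s > dir_alpha f} \<and>
     (\<forall>s. Re s > dir_alpha f \<longrightarrow> dir_series f s = exp (H s)) \<and>
     (\<forall>\<sigma>::real. \<sigma> > dir_alpha f \<longrightarrow> H (of_real \<sigma>) \<in> \<real>)"
proof -
  let ?\<alpha> = "dir_alpha f"
  obtain g where g: "g holomorphic_on {s. Re s > ?\<alpha>}"
      "\<And>s. s \<in> {s. Re s > ?\<alpha>} \<Longrightarrow> exp (g s) = dir_series f s"
  proof (rule holomorphic_logarithm_exists[of "{s. Re s > ?\<alpha>}" "dir_series f" "of_real (?\<alpha> + 1)"])
    show "dir_series f s \<noteq> 0" if "s \<in> {s. Re s > ?\<alpha>}" for s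
      using that assms by (auto simp: zero_free_dirichlet_def)
  qed (use assms in \<open>auto simp: convex_halfspace_Re_gt open_halfspace_Re_gt
         intro: holomorphic_on_dir_series\<close>)
  define k where "k \<sigma> = Im (g (of_real \<sigma>)) / (2 * pi)" for \<sigma>
  have k_Ints: "k \<sigma> \<in> \<int>" if "\<sigma> > ?\<alpha>" for \<sigma>
  proof -
    have "exp (g (of_real \<sigma>)) = of_real (F_real f \<sigma>)"
      using g(2)[of "of_real \<sigma>"] dir_series_of_real(1)[OF assms that] that by simp
    also have "\<dots> = exp (of_real (ln (F_real f \<sigma>)))"
      using dir_series_of_real(3)[OF assms that] by (simp only: exp_of_real exp_ln)
    finally obtain n :: int
      where "g (of_real \<sigma>) = of_real (ln (F_real f \<sigma>)) + (of_int (2 * n) * pi) * \<i>"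
      unfolding exp_eq by blast
    then have "k \<sigma> = of_int n"
      unfolding k_def by simp
    then show ?thesis by simp
  qed
  have "k constant_on {?\<alpha><..}"
  proof (rule continuous_discrete_range_constant)
    show "continuous_on {?\<alpha><..} k"
      unfolding k_def
      by (intro continuous_intros continuous_on_compose2[OF holomorphic_on_imp_continuous_on[OF g(1)]])
         auto
    \<comment> \<open>Distinct integers are at least 1 apart, so the range of \<open>k\<close> is
      discrete with gap 1.\<close>
    show "\<exists>e>0. \<forall>y. y \<in> {?\<alpha><..} \<and> k y \<noteq> k x \<longrightarrow> e \<le> norm (k y - k x)" if "x \<in> {?\<alpha><..}" for x
      using that k_Ints by (intro exI[of _ 1]) (auto intro!: Ints_nonzero_abs_ge1 Ints_diff)
  qed auto
  then obtain m where m: "\<And>\<sigma>. \<sigma> > ?\<alpha> \<Longrightarrow> k \<sigma> = m"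
    unfolding constant_on_def by auto
  have "m \<in> \<int>"
    using k_Ints[of "?\<alpha> + 1"] m[of "?\<alpha> + 1"] by simp
  then obtain n :: int where n: "m = of_int n" by (auto elim: Ints_cases)
  define H where "H s = g s - 2 * of_int n * pi * \<i>" for s
  have "exp (H s) = exp (g s)" for s
    unfolding exp_eq by (intro exI[of _ "- n"]) (simp add: H_def algebra_simps)
  then have "\<forall>s. Re s > ?\<alpha> \<longrightarrow> dir_series f s = exp (H s)"
    using g(2) by auto
  moreover have "H holomorphic_on {s. Re s > ?\<alpha>}"
    unfolding H_def by (intro holomorphic_intros g(1))
  moreover have "H (of_real \<sigma>) \<in> \<real>" if "\<sigma> > ?\<alpha>" for \<sigma>
    using m[OF that] by (auto simp: complex_is_Real_iff H_def k_def n field_simps)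
  ultimately show ?thesis by blast
qed

text \<open>Existence lets the choice in the definition of \<open>dir_log\<close> be replaced by its
  three defining properties; nothing else about the chosen function is used below.\<close>

lemma dir_log:
  assumes "zero_free_dirichlet f"
  shows holomorphic_on_dir_log: "dir_log f holomorphic_on {s. Re s > dir_alpha f}"
    and exp_dir_log: "Re s > dir_alpha f \<Longrightarrow> exp (dir_log f s) = dir_series f s"
    and dir_log_of_real: "\<sigma> > dir_alpha f \<Longrightarrow> dir_log f (of_real \<sigma>) \<in> \<real>"
  using someI_ex[OF dir_log_exists[OF assms]] unfolding dir_log_def[symmetric] by auto

text \<open>Along the real axis, the imaginary part of the logarithm is constantly 0, so its
  derivative vanishes. This makes the linear term of the expansion in \<open>t\<close> purely
  imaginary.\<close>

lemma Im_dir_a_of_real: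
  assumes "zero_free_dirichlet f" and "\<sigma> > dir_alpha f"
  shows "Im (dir_a f (of_real \<sigma>)) = 0"
proof -
  have "(dir_log f has_field_derivative dir_a f (of_real \<sigma>)) (at (of_real \<sigma>))"
    unfolding dir_a_def using assms
    by (intro holomorphic_derivI[OF holomorphic_on_dir_log]) (auto simp: open_halfspace_Re_gt)
  then have "((\<lambda>x. dir_log f (of_real x)) has_vector_derivative dir_a f (of_real \<sigma>)) (at \<sigma>)"
    by (rule has_vector_derivative_real_field)
  then have "((\<lambda>x. Im (dir_log f (of_real x))) has_real_derivative Im (dir_a f (of_real \<sigma>))) (at \<sigma>)"
    by (simp add: has_vector_derivative_complex_iff)
  moreover have "((\<lambda>x. Im (dir_log f (of_real x))) has_real_derivative 0) (at \<sigma>)"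
  proof (rule has_field_derivative_transform_within_open[of "\<lambda>_. 0" _ _ "{dir_alpha f<..}"])
    show "0 = Im (dir_log f (of_real x))" if "x \<in> {dir_alpha f<..}" for x
      using dir_log_of_real[OF assms(1), of x] that by (simp add: complex_is_Real_iff)
  qed (use assms in auto)
  ultimately show ?thesis
    by (rule DERIV_unique)
qed

section \<open>The quadratic expansion on a vertical line\<close>

text \<open>Complex Taylor of order 2 on the vertical line itself: the line is convex, so a bound
  for the third derivative on it is enough.\<close>

lemma norm_dir_remainder_le:
  assumes "zero_free_dirichlet f" and "\<sigma> > dir_alpha f"
    and B: "\<And>t. norm (dir_c f (Complex \<sigma> t)) \<le> B"
  shows "norm (dir_remainder f (Complex \<sigma> t)) \<le> B * \<bar>t\<bar> ^ 3"
proof -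
  let ?D = "\<lambda>i. (deriv ^^ i) (dir_log f)" and ?L = "{s. Re s = \<sigma>}"
  let ?w = "complex_of_real \<sigma>" and ?z = "Complex \<sigma> t"
  have holo: "?D i holomorphic_on {s. Re s > dir_alpha f}" for i
    by (intro holomorphic_higher_deriv holomorphic_on_dir_log assms open_halfspace_Re_gt)
  have "cmod (?D 0 ?z - (\<Sum>i\<le>2. ?D i ?w * (?z - ?w) ^ i / fact i))
          \<le> B * cmod (?z - ?w) ^ Suc 2 / fact 2"
  proof (rule complex_Taylor[of ?L])
    show "convex ?L"
      by (auto simp: convex_def algebra_simps simp flip: distrib_right)
    show "(?D i has_field_derivative ?D (Suc i) s) (at s within ?L)" if "s \<in> ?L" for i s
      using holomorphic_derivI[OF holo open_halfspace_Re_gt, of s i ?L] that assms(2) by simp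
    show "cmod (?D (Suc 2) s) \<le> B" if "s \<in> ?L" for s
      using B[of "Im s"] that by (auto simp: dir_c_def numeral_3_eq_3 numeral_2_eq_2)
  qed auto
  moreover have zw: "?z - ?w = \<i> * of_real t"
    by (simp add: complex_eq_iff)
  moreover have "?D 0 ?z - (\<Sum>i\<le>2. ?D i ?w * (?z - ?w) ^ i / fact i) = dir_remainder f ?z"
    unfolding zw
    by (simp add: dir_remainder_def dir_a_def dir_b_def numeral_2_eq_2 power_mult_distrib field_simps)
  ultimately have "norm (dir_remainder f ?z) \<le> B * \<bar>t\<bar> ^ 3 / 2"
    by (simp add: norm_mult numeral_3_eq_3 numeral_2_eq_2)
  \<comment> \<open>Nonnegativity of \<open>B\<close> allows the factor 1/2 from
    \<open>fact 2\<close> to be dropped.\<close>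
  moreover have "0 \<le> B"
    using norm_ge_zero B[of 0] by (rule order_trans)
  ultimately show ?thesis
    by (smt (verit) divide_le_eq_numeral1(1) mult_nonneg_nonneg zero_le_power abs_ge_zero field_sum_of_halves)
qed

text \<open>Since the modulus of \<open>exp w\<close> is \<open>exp (Re w)\<close>, this is the real
  part of the expansion of the logarithm, from which the linear term disappears. It turns a bound on
  the series at a single point into a bound on \<open>exp (- b * t^2 / 2)\<close>.\<close>

lemma norm_dir_series_eq:
  assumes "zero_free_dirichlet f" and "\<sigma> > dir_alpha f"
  shows "norm (dir_series f (Complex \<sigma> t)) / F_real f \<sigma>
    = exp (Re (dir_remainder f (Complex \<sigma> t)) - b_real f \<sigma> * t\<^sup>2 / 2)"
proof -
  have norm_eq: "norm (dir_series f s) = exp (Re (dir_log f s))" if "Re s > dir_alpha f" for s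
    using exp_dir_log[OF assms(1) that] by (metis norm_exp_eq_Re)
  have "F_real f \<sigma> = norm (dir_series f (of_real \<sigma>))"
    using dir_series_of_real[OF assms] by simp
  then have "norm (dir_series f (Complex \<sigma> t)) / F_real f \<sigma>
      = exp (Re (dir_log f (Complex \<sigma> t)) - Re (dir_log f (of_real \<sigma>)))"
    using assms by (simp add: norm_eq exp_diff)
  also have "Re (dir_log f (Complex \<sigma> t)) - Re (dir_log f (of_real \<sigma>))
      = Re (dir_remainder f (Complex \<sigma> t)) - b_real f \<sigma> * t\<^sup>2 / 2"
    using Im_dir_a_of_real[OF assms]
    by (simp add: dir_remainder_def b_real_def power2_eq_square)
  finally show ?thesis .
qed

section \<open>The integral over the tail\<close>

text \<open>The substitution \<open>t = a * x\<close> reduces both claims to the integral of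
  \<open>1 / (1 + x^2)\<close> over the line, which is \<open>pi\<close>.\<close>

lemma
  fixes a :: real
  assumes "0 < a"
  shows integrable_inverse_square_plus: "integrable lborel (\<lambda>t. 1 / (a\<^sup>2 + t\<^sup>2))"
    and integral_inverse_square_plus: "(LBINT t. 1 / (a\<^sup>2 + t\<^sup>2)) = pi / a"
proof -
  let ?g = "\<lambda>t::real. 1 / (a\<^sup>2 + t\<^sup>2)"
  have scale: "?g (0 + a * x) = inverse (1 + x\<^sup>2) / a\<^sup>2" for x
  proof -
    have "a\<^sup>2 + (0 + a * x)\<^sup>2 = a\<^sup>2 * (1 + x\<^sup>2)"
      by (simp add: algebra_simps power_mult_distrib)
    then show ?thesis
      by (simp add: field_simps)
  qed
  have "integrable lborel (\<lambda>x::real. inverse (1 + x\<^sup>2))"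
    using integrable_inverse_1_plus_square by (simp add: set_integrable_def)
  then show "integrable lborel ?g"
    using assms by (subst lborel_integrable_real_affine_iff[of a ?g 0, symmetric]) (auto simp only: scale intro!: integrable_divide)
  have "(LBINT x. inverse (1 + x\<^sup>2)) = pi"
    using LBINT_inverse_1_plus_square
    by (simp add: interval_lebesgue_integral_def set_lebesgue_integral_def)
  then show "(LBINT t. ?g t) = pi / a"
    using assms by (subst lborel_integral_real_affine[of a _ 0]) (simp_all only: scale, simp_all add: power2_eq_square)
qed

text \<open>
  On \<open>\<delta> \<le> \<bar>t\<bar> \<le> T\<close> the hypothesis bounds \<open>\<bar>F(\<sigma> + it)\<bar>\<close> by \<open>F(\<sigma>) / T\<close>. For \<open>\<bar>t\<bar> > T\<close> the trivial bound
  \<open>F(\<sigma>)\<close> is combined with \<open>1 / t\<^sup>2 \<le> 2 / (T\<^sup>2 + t\<^sup>2)\<close>, so that one integral serves both ranges.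
\<close>

lemma tail_integral_le:
  assumes f: "zero_free_dirichlet f" "\<sigma> > dir_alpha f" and T: "0 < T"
    and bound: "\<And>t. \<delta> \<le> \<bar>t\<bar> \<Longrightarrow> \<bar>t\<bar> \<le> T \<Longrightarrow> T * norm (dir_series f (Complex \<sigma> t)) / F_real f \<sigma> \<le> 1"
  shows "(LINT t:{t. \<bar>t\<bar> \<ge> \<delta>}|lborel. norm (dir_series f (Complex \<sigma> t)) / (\<sigma>\<^sup>2 + t\<^sup>2))
    \<le> F_real f \<sigma> * (pi / (\<sigma> * T) + 2 * pi / T)"
proof -
  let ?F = "F_real f \<sigma>"
  let ?h = "\<lambda>t. ?F / T * (1 / (\<sigma>\<^sup>2 + t\<^sup>2)) + 2 * ?F * (1 / (T\<^sup>2 + t\<^sup>2))"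
  have \<sigma>: "0 < \<sigma>"
    using dir_alpha_nonneg[OF f(1)] f(2) by simp
  have F: "0 < ?F"
    by (rule dir_series_of_real(3)[OF f])
  have pos: "0 < \<sigma>\<^sup>2 + t\<^sup>2" "0 < T\<^sup>2 + t\<^sup>2" for t
    using \<sigma> T by (auto intro!: add_pos_nonneg)
  have h_nonneg: "0 \<le> ?h t" for t
    using F T pos[of t] by (intro add_nonneg_nonneg mult_nonneg_nonneg divide_nonneg_nonneg) auto
  have "(LINT t:{t. \<bar>t\<bar> \<ge> \<delta>}|lborel. norm (dir_series f (Complex \<sigma> t)) / (\<sigma>\<^sup>2 + t\<^sup>2)) \<le> (LBINT t. ?h t)"
    unfolding set_lebesgue_integral_def
  \<comment> \<open>This rule asks for integrability of the majorant alone: a non-integrable left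
    side would have the default value 0, which \<open>h_nonneg\<close> covers.\<close>
  proof (rule integral_mono')
    show "integrable lborel ?h"
      using \<sigma> T by (intro Bochner_Integration.integrable_add integrable_mult_right
          integrable_inverse_square_plus)
    fix t :: real
    have "norm (dir_series f (Complex \<sigma> t)) / (\<sigma>\<^sup>2 + t\<^sup>2) \<le> ?h t" if "\<delta> \<le> \<bar>t\<bar>"
    proof (cases "\<bar>t\<bar> \<le> T")
      case True
      then have "norm (dir_series f (Complex \<sigma> t)) \<le> ?F / T"
        using bound[OF that True] F T by (simp add: field_simps)
      then have "norm (dir_series f (Complex \<sigma> t)) / (\<sigma>\<^sup>2 + t\<^sup>2) \<le> ?F / T * (1 / (\<sigma>\<^sup>2 + t\<^sup>2))"
        using pos(1)[of t] divide_right_mono[of _ "?F / T" "\<sigma>\<^sup>2 + t\<^sup>2"] by simp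
      also have "\<dots> \<le> ?h t"
        using F pos[of t] by simp
      finally show ?thesis .
    next
      case False
      then have "T\<^sup>2 \<le> t\<^sup>2"
        using T by (simp add: abs_le_square_iff[symmetric])
      then have "T\<^sup>2 + t\<^sup>2 \<le> 2 * (\<sigma>\<^sup>2 + t\<^sup>2)"
        using zero_le_power2[of \<sigma>] by argo
      then have "1 / (\<sigma>\<^sup>2 + t\<^sup>2) \<le> 2 * (1 / (T\<^sup>2 + t\<^sup>2))"
        using pos[of t] by (simp add: divide_simps)
      then have "?F * (1 / (\<sigma>\<^sup>2 + t\<^sup>2)) \<le> 2 * ?F * (1 / (T\<^sup>2 + t\<^sup>2))"
        using F mult_left_mono[of "1 / (\<sigma>\<^sup>2 + t\<^sup>2)" "2 * (1 / (T\<^sup>2 + t\<^sup>2))" ?F] by (simp add: mult.commute)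
      moreover have "norm (dir_series f (Complex \<sigma> t)) / (\<sigma>\<^sup>2 + t\<^sup>2) \<le> ?F * (1 / (\<sigma>\<^sup>2 + t\<^sup>2))"
        using norm_dir_series_le[OF f, of t] pos(1)[of t] by (simp add: divide_right_mono)
      moreover have "0 \<le> ?F / T * (1 / (\<sigma>\<^sup>2 + t\<^sup>2))"
        using F T pos(1)[of t] by simp
      ultimately show ?thesis by linarith
    qed
    then show "indicator {t. \<bar>t\<bar> \<ge> \<delta>} t *\<^sub>R (norm (dir_series f (Complex \<sigma> t)) / (\<sigma>\<^sup>2 + t\<^sup>2)) \<le> ?h t"
      using h_nonneg[of t] by (auto simp: indicator_def)
    show "0 \<le> ?h t"
      by (rule h_nonneg)
  qed
  also have "(LBINT t. ?h t) = ?F / T * (pi / \<sigma>) + 2 * ?F * (pi / T)"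
    using \<sigma> T
    by (subst Bochner_Integration.integral_add)
       (auto simp only: integral_mult_right_zero integral_inverse_square_plus
         intro!: integrable_mult_right integrable_inverse_square_plus)
  also have "\<dots> = ?F * (pi / (\<sigma> * T) + 2 * pi / T)"
    by (simp add: algebra_simps)
  finally show ?thesis .
qed

theorem theorem21:
  fixes f :: "nat \<Rightarrow> real"
  assumes "T_admissible f"
  shows "admissible f"
proof -
  define \<alpha> where "\<alpha> = dir_alpha f"
  define F where "F = F_real f"
  define b where "b = b_real f"
  define c where "c = c_real f"
  define \<delta> where "\<delta> = (\<lambda>\<sigma>. \<bar>b \<sigma> * c \<sigma>\<bar> powr (- 1 / 5))"
  have f: "zero_free_dirichlet f"
    using assms by (simp add: T_admissible_def)
  obtain \<beta> T where \<beta>: "\<alpha> < \<beta>"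
    and bc: "\<forall>\<sigma>\<in>{\<alpha><..<\<beta>}. b \<sigma> * c \<sigma> \<noteq> 0"
    and T: "\<forall>\<sigma>\<in>{\<alpha><..<\<beta>}. T \<sigma> > 0"
    and T1: "filterlim (\<lambda>\<sigma>. \<sigma>\<^sup>2 * b \<sigma>) at_top (at_right \<alpha>)"
    and T2: "filterlim (\<lambda>\<sigma>. b \<sigma> ^ 3 / (c \<sigma>)\<^sup>2) at_top (at_right \<alpha>)"
    and T3: "\<forall>\<sigma>\<in>{\<alpha><..<\<beta>}. \<forall>t. \<delta> \<sigma> \<le> \<bar>t\<bar> \<and> \<bar>t\<bar> \<le> T \<sigma> \<longrightarrow>
            T \<sigma> * norm (dir_series f (Complex \<sigma> t)) / F \<sigma> \<le> 1"
    and T4: "((\<lambda>\<sigma>. sqrt (b \<sigma>) / T \<sigma>) \<longlongrightarrow> 0) (at_right \<alpha>)"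
    and T5: "\<forall>\<sigma>\<in>{\<alpha><..<\<beta>}. \<forall>t. norm (dir_c f (Complex \<sigma> t)) \<le> \<bar>c \<sigma>\<bar>"
    and T6: "Liminf (at_right \<alpha>) (\<lambda>\<sigma>. ereal \<bar>c \<sigma>\<bar>) > 0"
    using assms unfolding T_admissible_def Let_def \<alpha>_def F_def b_def c_def \<delta>_def by blast
  have near: "\<forall>\<^sub>F \<sigma> in at_right \<alpha>. \<sigma> \<in> {\<alpha><..<\<beta>}"
    using \<beta> by (rule eventually_at_right_real)

  \<comment> \<open>Growth of \<open>b\<close> and decay of \<open>\<delta>\<close>\<close>
  \<comment> \<open>A positive real strictly below the lower limit in (T6) is eventually a lower
    bound for \<open>\<bar>c \<sigma>\<bar>\<close>.\<close>
  obtain c0 where c0: "0 < c0" "\<forall>\<^sub>F \<sigma> in at_right \<alpha>. c0 < \<bar>c \<sigma>\<bar>"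
  proof -
    obtain c0 where "0 < ereal c0" "ereal c0 < Liminf (at_right \<alpha>) (\<lambda>\<sigma>. ereal \<bar>c \<sigma>\<bar>)"
      using T6 ereal_dense2 by blast
    then show ?thesis
      using less_LiminfD[of "ereal c0" "at_right \<alpha>" "\<lambda>\<sigma>. ereal \<bar>c \<sigma>\<bar>"] that by simp
  qed
  \<comment> \<open>The threshold \<open>K ^ 3 / c0^2\<close> in (T2) is chosen so that multiplying
    by \<open>c^2 \<ge> c0^2\<close> leaves \<open>K ^ 3 \<le> b ^ 3\<close>. The sign of
    \<open>b\<close> is not known beforehand; it comes from the odd power, before cube roots are
    taken.\<close>
  have b_top: "filterlim b at_top (at_right \<alpha>)"
    unfolding filterlim_at_top_gt[where c = 0]
  proof (intro allI impI)
    fix K :: real assume K: "0 < K"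
    have "\<forall>\<^sub>F \<sigma> in at_right \<alpha>. K ^ 3 / c0\<^sup>2 \<le> b \<sigma> ^ 3 / (c \<sigma>)\<^sup>2"
      using T2 by (simp add: filterlim_at_top)
    with c0(2) show "\<forall>\<^sub>F \<sigma> in at_right \<alpha>. K \<le> b \<sigma>"
    proof eventually_elim
      case (elim \<sigma>)
      have c2: "c0\<^sup>2 \<le> (c \<sigma>)\<^sup>2"
        using elim(1) c0(1) by (simp add: abs_le_square_iff[symmetric])
      have "K ^ 3 = K ^ 3 / c0\<^sup>2 * c0\<^sup>2"
        using c0(1) by simp
      also have "\<dots> \<le> b \<sigma> ^ 3 / (c \<sigma>)\<^sup>2 * (c \<sigma>)\<^sup>2"
        using elim(2) c2 K by (intro mult_mono) (auto intro: order_trans[OF _ elim(2)])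
      also have "\<dots> = b \<sigma> ^ 3"
        using elim(1) c0(1) by auto
      finally have le: "K ^ 3 \<le> b \<sigma> ^ 3" .
      have "0 < K ^ 3"
        using K by simp
      then have "0 < b \<sigma> ^ 3"
        using le by (rule less_le_trans)
      then have "0 < b \<sigma>"
        by (simp add: zero_less_power_eq)
      then show "K \<le> b \<sigma>"
        using K le by (simp add: power_mono_iff)
    qed
  qed
  have b_gt_1: "\<forall>\<^sub>F \<sigma> in at_right \<alpha>. 1 < b \<sigma>"
    using b_top by (simp add: filterlim_at_top_dense)

  have "filterlim (\<lambda>\<sigma>. \<bar>b \<sigma> * c \<sigma>\<bar>) at_top (at_right \<alpha>)"
  proof (rule filterlim_at_top_mono)
    show "filterlim (\<lambda>\<sigma>. c0 * b \<sigma>) at_top (at_right \<alpha>)"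
      using c0(1) b_top by (rule filterlim_tendsto_pos_mult_at_top[OF tendsto_const])
    show "\<forall>\<^sub>F \<sigma> in at_right \<alpha>. c0 * b \<sigma> \<le> \<bar>b \<sigma> * c \<sigma>\<bar>"
      using b_gt_1 c0(2)
    proof eventually_elim
      case (elim \<sigma>)
      then show ?case
        using mult_right_mono[of c0 "\<bar>c \<sigma>\<bar>" "b \<sigma>"] by (simp add: abs_mult mult.commute)
    qed
  qed
  then have \<delta>_lim: "(\<delta> \<longlongrightarrow> 0) (at_right \<alpha>)"
    unfolding \<delta>_def by (intro tendsto_neg_powr) auto
  have \<delta>_lt_1: "\<forall>\<^sub>F \<sigma> in at_right \<alpha>. \<delta> \<sigma> < 1"
    by (rule order_tendstoD(2)[OF \<delta>_lim]) simp
  have \<delta>_pos: "0 < \<delta> \<sigma>" if "\<sigma> \<in> {\<alpha><..<\<beta>}" for \<sigma>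
    using bc that by (auto simp: \<delta>_def)

  \<comment> \<open>The remainder condition and the decay of
    \<open>b * exp (- b * \<delta>^2)\<close>\<close>
  have A7: "\<forall>\<epsilon>>0. \<forall>\<^sub>F \<sigma> in at_right \<alpha>. \<forall>t. \<bar>t\<bar> \<le> \<delta> \<sigma> \<longrightarrow> norm (dir_remainder f (Complex \<sigma> t)) < \<epsilon>"
  proof (intro allI impI)
    fix \<epsilon> :: real assume "0 < \<epsilon>"
    have "((\<lambda>\<sigma>. (b \<sigma> ^ 3 / (c \<sigma>)\<^sup>2) powr (- 1 / 5)) \<longlongrightarrow> 0) (at_right \<alpha>)"
      using T2 by (intro tendsto_neg_powr) auto
    then have "\<forall>\<^sub>F \<sigma> in at_right \<alpha>. (b \<sigma> ^ 3 / (c \<sigma>)\<^sup>2) powr (- 1 / 5) < \<epsilon>"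
      using \<open>0 < \<epsilon>\<close> by (rule order_tendstoD(2))
    with near b_gt_1 show "\<forall>\<^sub>F \<sigma> in at_right \<alpha>. \<forall>t. \<bar>t\<bar> \<le> \<delta> \<sigma> \<longrightarrow> norm (dir_remainder f (Complex \<sigma> t)) < \<epsilon>"
    proof eventually_elim
      case (elim \<sigma>)
      have "0 < b \<sigma>" "0 < \<bar>c \<sigma>\<bar>"
        using elim bc by auto
      \<comment> \<open>In the variables \<open>x = ln b\<close> and
        \<open>y = ln \<bar>c\<bar>\<close>, the identity between
        \<open>\<bar>c\<bar> * \<delta>^3\<close> and the power -1/5 of \<open>b^3 / c^2\<close>
        becomes linear arithmetic in the exponents.\<close>
      then obtain x y where xy: "b \<sigma> = exp x" "\<bar>c \<sigma>\<bar> = exp y"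
        by (metis exp_ln)
      have "\<bar>b \<sigma> * c \<sigma>\<bar> = exp (x + y)"
        by (simp add: abs_mult xy exp_add)
      then have "\<delta> \<sigma> = exp ((x + y) * (- 1 / 5))"
        by (simp only: \<delta>_def exp_powr_real)
      then have "\<bar>c \<sigma>\<bar> * \<delta> \<sigma> ^ 3 = exp (y + 3 * ((x + y) * (- 1 / 5)))"
        by (simp only: xy exp_add[of y] exp_of_nat_mult[of 3, simplified])
      also have "y + 3 * ((x + y) * (- 1 / 5)) = (3 * x - 2 * y) * (- 1 / 5)"
        by (simp add: field_simps)
      also have "exp \<dots> = exp (3 * x - 2 * y) powr (- 1 / 5)"
        by (simp only: exp_powr_real)
      also have "exp (3 * x - 2 * y) = b \<sigma> ^ 3 / \<bar>c \<sigma>\<bar>\<^sup>2"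
        unfolding xy by (simp add: exp_diff flip: exp_of_nat_mult)
      finally have c\<delta>: "\<bar>c \<sigma>\<bar> * \<delta> \<sigma> ^ 3 < \<epsilon>"
        using elim(3) by simp
      show ?case
      proof (intro allI impI)
        fix t assume t: "\<bar>t\<bar> \<le> \<delta> \<sigma>"
        have "norm (dir_remainder f (Complex \<sigma> t)) \<le> \<bar>c \<sigma>\<bar> * \<bar>t\<bar> ^ 3"
          using T5 elim(1) by (intro norm_dir_remainder_le f) (auto simp: \<alpha>_def)
        also have "\<dots> \<le> \<bar>c \<sigma>\<bar> * \<delta> \<sigma> ^ 3"
          using t by (intro mult_left_mono power_mono) auto
        finally show "norm (dir_remainder f (Complex \<sigma> t)) < \<epsilon>"
          using c\<delta> by simp
      qed
    qed
  qed

  \<comment> \<open>This places \<open>t = \<delta>\<close> in the range of (T3): eventually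
    \<open>\<delta> < 1 < sqrt b < T\<close>, the last inequality by (T4).\<close>
  have \<delta>_le_T: "\<forall>\<^sub>F \<sigma> in at_right \<alpha>. \<delta> \<sigma> \<le> T \<sigma>"
    using near b_gt_1 \<delta>_lt_1 order_tendstoD(2)[OF T4, of 1, simplified]
  proof eventually_elim
    case (elim \<sigma>)
    then have "sqrt (b \<sigma>) < T \<sigma>" "1 < sqrt (b \<sigma>)"
      using T by (auto simp: divide_less_eq)
    with elim(3) show ?case by linarith
  qed

  text \<open>(T2) only gives \<open>b \<delta>\<^sup>2 \<rightarrow> \<infinity>\<close>, at no particular rate, hence the use of (T3) and (T4).\<close>
  have A6: "((\<lambda>\<sigma>. b \<sigma> * exp (- b \<sigma> * (\<delta> \<sigma>)\<^sup>2)) \<longlongrightarrow> 0) (at_right \<alpha>)"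
  proof (rule tendsto_sandwich[OF _ _ tendsto_const])
    show "((\<lambda>\<sigma>. (sqrt (b \<sigma>) / T \<sigma>)\<^sup>2 * (exp 1)\<^sup>2) \<longlongrightarrow> 0) (at_right \<alpha>)"
      using tendsto_mult_right[OF tendsto_power[OF T4, of 2], of "(exp 1)\<^sup>2"] by simp
    show "\<forall>\<^sub>F \<sigma> in at_right \<alpha>. 0 \<le> b \<sigma> * exp (- b \<sigma> * (\<delta> \<sigma>)\<^sup>2)"
      using b_gt_1 by eventually_elim simp
    show "\<forall>\<^sub>F \<sigma> in at_right \<alpha>. b \<sigma> * exp (- b \<sigma> * (\<delta> \<sigma>)\<^sup>2) \<le> (sqrt (b \<sigma>) / T \<sigma>)\<^sup>2 * (exp 1)\<^sup>2"
      using near b_gt_1 \<delta>_le_T A7[rule_format, of 1, simplified]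
    proof eventually_elim
      case (elim \<sigma>)
      let ?R = "dir_remainder f (Complex \<sigma> (\<delta> \<sigma>))"
      have \<sigma>: "0 < \<delta> \<sigma>" "0 < T \<sigma>" "dir_alpha f < \<sigma>"
        using \<delta>_pos elim(1) T by (auto simp: \<alpha>_def)
      \<comment> \<open>Only boundedness of the remainder matters here; the bound 1 is what produces
        the factor \<open>exp 1\<close>.\<close>
      have "\<bar>Re ?R\<bar> < 1"
        using elim(4)[rule_format, of "\<delta> \<sigma>"] \<sigma>(1) abs_Re_le_cmod[of ?R] by simp
      then have "exp (- b \<sigma> * (\<delta> \<sigma>)\<^sup>2 / 2) \<le> exp (1 + (Re ?R - b \<sigma> * (\<delta> \<sigma>)\<^sup>2 / 2))"
        by simp
      also have "\<dots> = exp 1 * (norm (dir_series f (Complex \<sigma> (\<delta> \<sigma>))) / F \<sigma>)"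
        unfolding F_def b_def norm_dir_series_eq[OF f \<sigma>(3)] by (simp add: exp_add)
      also have "\<dots> \<le> exp 1 * (1 / T \<sigma>)"
      proof (rule mult_left_mono)
        have "T \<sigma> * norm (dir_series f (Complex \<sigma> (\<delta> \<sigma>))) / F \<sigma> \<le> 1"
          using T3 elim(1,3) \<sigma>(1) by auto
        then show "norm (dir_series f (Complex \<sigma> (\<delta> \<sigma>))) / F \<sigma> \<le> 1 / T \<sigma>"
          using \<sigma>(2) by (simp add: pos_le_divide_eq mult.commute)
      qed simp
      \<comment> \<open>Squaring removes the 1/2 from the exponent and produces the
        \<open>1 / T^2\<close> that compensates the factor \<open>b\<close>.\<close>
      finally have "(exp (- b \<sigma> * (\<delta> \<sigma>)\<^sup>2 / 2))\<^sup>2 \<le> (exp 1 * (1 / T \<sigma>))\<^sup>2"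
        by (rule power_mono) simp
      then have "exp (- b \<sigma> * (\<delta> \<sigma>)\<^sup>2) \<le> (exp 1 * (1 / T \<sigma>))\<^sup>2"
        by (simp flip: exp_double)
      then have "b \<sigma> * exp (- b \<sigma> * (\<delta> \<sigma>)\<^sup>2) \<le> b \<sigma> * (exp 1 * (1 / T \<sigma>))\<^sup>2"
        using elim(2) by (intro mult_left_mono) auto
      then show ?case
        using elim(2) by (simp add: power_divide power_mult_distrib)
    qed
  qed

  \<comment> \<open>The integral condition\<close>
  have A8: "((\<lambda>\<sigma>. \<sigma> * sqrt (b \<sigma>) / F \<sigma> *
      (LINT t:{t. \<bar>t\<bar> \<ge> \<delta> \<sigma>}|lborel. norm (dir_series f (Complex \<sigma> t)) / (\<sigma>\<^sup>2 + t\<^sup>2)))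
    \<longlongrightarrow> 0) (at_right \<alpha>)" (is "((\<lambda>\<sigma>. ?C \<sigma> * ?I \<sigma>) \<longlongrightarrow> 0) _")
  proof (rule tendsto_sandwich[OF _ _ tendsto_const])
    \<comment> \<open>This majorant is the prefactor times the bound of
      \<open>tail_integral_le\<close>, after cancelling \<open>F\<close> and
      \<open>\<sigma>\<close>. Its second factor stays bounded because \<open>\<alpha>\<close> is
      finite, so (T4) suffices.\<close>
    have "((\<lambda>\<sigma>. sqrt (b \<sigma>) / T \<sigma> * (pi + 2 * pi * \<sigma>)) \<longlongrightarrow> 0 * (pi + 2 * pi * \<alpha>)) (at_right \<alpha>)"
      by (intro tendsto_intros T4)
    then show "((\<lambda>\<sigma>. sqrt (b \<sigma>) / T \<sigma> * (pi + 2 * pi * \<sigma>)) \<longlongrightarrow> 0) (at_right \<alpha>)"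
      by simp
    have C: "0 \<le> ?C \<sigma>" "0 < \<sigma>" "0 < F \<sigma>" if "\<sigma> \<in> {\<alpha><..<\<beta>}" "1 < b \<sigma>" for \<sigma>
      using that dir_alpha_nonneg[OF f] dir_series_of_real(3)[OF f, of \<sigma>]
      by (auto simp: \<alpha>_def F_def)
    show "\<forall>\<^sub>F \<sigma> in at_right \<alpha>. 0 \<le> ?C \<sigma> * ?I \<sigma>"
      using near b_gt_1
    proof eventually_elim
      case (elim \<sigma>)
      then show ?case
        unfolding set_lebesgue_integral_def
        by (intro mult_nonneg_nonneg C integral_nonneg_AE) auto
    qed
    show "\<forall>\<^sub>F \<sigma> in at_right \<alpha>. ?C \<sigma> * ?I \<sigma> \<le> sqrt (b \<sigma>) / T \<sigma> * (pi + 2 * pi * \<sigma>)"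
      using near b_gt_1
    proof eventually_elim
      case (elim \<sigma>)
      have "0 < T \<sigma>"
        using T elim by auto
      then have "?I \<sigma> \<le> F \<sigma> * (pi / (\<sigma> * T \<sigma>) + 2 * pi / T \<sigma>)"
        using T3 elim(1) unfolding F_def by (intro tail_integral_le f) (auto simp: \<alpha>_def)
      then have "?C \<sigma> * ?I \<sigma> \<le> ?C \<sigma> * (F \<sigma> * (pi / (\<sigma> * T \<sigma>) + 2 * pi / T \<sigma>))"
        by (intro mult_left_mono C elim)
      also have "\<dots> = sqrt (b \<sigma>) / T \<sigma> * (pi + 2 * pi * \<sigma>)"
        using C[OF elim] \<open>0 < T \<sigma>\<close> by (simp add: field_simps)
      finally show ?case .
    qed
  qed

  have "\<forall>\<^sub>F \<sigma> in at_right \<alpha>. 0 < \<delta> \<sigma> \<and> \<delta> \<sigma> < 1"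
    using near \<delta>_lt_1 by eventually_elim (simp add: \<delta>_pos)
  \<comment> \<open>The bound \<open>\<delta> < 1\<close> is known only near
    \<open>\<alpha>\<close>, so a new right end \<open>\<beta>'\<close> replaces
    \<open>\<beta>\<close>.\<close>
  then obtain \<beta>' where "\<alpha> < \<beta>'" "\<forall>\<sigma>\<in>{\<alpha><..<\<beta>'}. 0 < \<delta> \<sigma> \<and> \<delta> \<sigma> < 1"
    unfolding eventually_at_right_field by auto
  then show ?thesis
    using f \<delta>_lim T1 A6 A7 A8
    unfolding admissible_def Let_def \<alpha>_def F_def b_def by blast
qed

end
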